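(* Let $X$ be an atomic Archimedean vector lattice. For every net $(x_\alpha)$ in $X$ and every $x\in X$, the net $(x_\alpha)$ is unbounded order convergent to $x$ if and only if it converges pointwise to $x$, that is, $P_a x_\alpha\to P_a x$ in the one-dimensional space $\mathrm{span}\{a\}$ for every atom $a\in X$.
   Context: A net $(x_\alpha)_{\alpha\in A}$ in a vector lattice $X$ is order convergent to $x\in X$ if there is a net $(y_\beta)_{\beta\in B}$ in $X$ (with a possibly different index set) such that $y_\beta\downarrow 0$ (decreasing with infimum $0$) and for each $\beta\in B$ there is $\alpha_\beta\in A$ with $|x_\alpha-x|\le y_\beta$ for all $\alpha\ge\alpha_\beta$. A net $(x_\alpha)$ is unbounded order convergent ($uo$-convergent) to $x$ if, for every $u\in X_+$, the net $|x_\alpha-x|\wedge u$ is order convergent to $0$. An element $a>0$ of $X$ is an atom if for every $y\in[0,a]$ there is a real $\lambda\ge 0$ with $y=\lambda a$. In an Archimedean vector lattice the band $B_a$ generated by an atom $a$ is a projection band and $B_a=\mathrm{span}\{a\}$; $P_a$ denotes the band projection onto $B_a$. $X$ is atomic if the band generated by its atoms is $X$. Convergence in $\mathrm{span}\{a\}$ is the usual convergence of the real coefficients of $a$. *)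

theory Defs
  imports
    Complex_Main
    "HOL-Library.Lattice_Algebras"
    "HOL-Library.Lub_Glb"
begin

section \<open>Vector lattices\<close>

class vector_lattice = ordered_real_vector + lattice_ab_group_add_abs

definition archimedean_lattice :: "'a::vector_lattice itself \<Rightarrow> bool" where
  "archimedean_lattice _ \<longleftrightarrow>
     (\<forall>x y :: 'a. (\<forall>n::nat. real n *\<^sub>R x \<le> y) \<longrightarrow> x \<le> 0)"

text \<open>
  Bands and band projections. In \<open>isLub UNIV\<close> and \<open>isGlb UNIV\<close> the set \<open>UNIV\<close> says that the
  supremum or infimum is taken in the whole vector lattice.
\<close>

definition solid :: "'a::vector_lattice set \<Rightarrow> bool" where
  "solid I \<longleftrightarrow> (\<forall>x y. y \<in> I \<and> \<bar>x\<bar> \<le> \<bar>y\<bar> \<longrightarrow> x \<in> I)"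

definition order_ideal :: "'a::vector_lattice set \<Rightarrow> bool" where
  "order_ideal I \<longleftrightarrow> subspace I \<and> solid I"

definition band :: "'a::vector_lattice set \<Rightarrow> bool" where
  "band B \<longleftrightarrow> order_ideal B \<and> (\<forall>S s. S \<subseteq> B \<and> isLub UNIV S s \<longrightarrow> s \<in> B)"

definition disjoint_complement :: "'a::vector_lattice set \<Rightarrow> 'a set" where
  "disjoint_complement S = {x. \<forall>s\<in>S. inf \<bar>x\<bar> \<bar>s\<bar> = 0}"

text \<open>
  This is meaningful only if \<open>B\<close> is a projection band, i.e. if the space is the direct sum of \<open>B\<close>
  and its disjoint complement. For the band generated by an atom of an Archimedean vector lattice,
  this is \<open>projection_band_atom\<close> below.
\<close>

definition band_projection :: "'a::vector_lattice set \<Rightarrow> 'a \<Rightarrow> 'a" where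
  "band_projection B x = (THE y. y \<in> B \<and> x - y \<in> disjoint_complement B)"

definition is_atom :: "'a::vector_lattice \<Rightarrow> bool" where
  "is_atom a \<longleftrightarrow> a > 0 \<and> (\<forall>y. 0 \<le> y \<and> y \<le> a \<longrightarrow> (\<exists>c::real. c \<ge> 0 \<and> y = c *\<^sub>R a))"

definition atomic_lattice :: "'a::vector_lattice itself \<Rightarrow> bool" where
  "atomic_lattice _ \<longleftrightarrow> band hull {a::'a. is_atom a} = UNIV"


section \<open>The band generated by an atom\<close>

lemma inf_add_le:
  fixes x y z :: "'a::vector_lattice"
  assumes "0 \<le> x" "0 \<le> y" "0 \<le> z"
  shows "inf (x + y) z \<le> inf x z + inf y z"
proof -
  have 1: "inf x z + inf y z = inf (inf x z + y) (inf x z + z)"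
    by (rule add_inf_distrib_left)
  have 2: "inf x z + w = inf (x + w) (z + w)" for w
    by (rule add_inf_distrib_right)
  have "w \<le> z + v" if "w \<le> z" "0 \<le> v" for v w
    using add_mono[OF that] by simp
  then have "inf (x + y) z \<le> z + y" "inf (x + y) z \<le> z + z"
    using assms by auto
  moreover have "inf (x + y) z \<le> x + z"
    using add_mono[of 0 x "inf (x + y) z" z] assms by simp
  ultimately show ?thesis unfolding 1 2
    by (simp only: add.commute[of _ "inf y z"] add_inf_distrib_right add_inf_distrib_left le_inf_iff) (simp add: 1 2 add.commute)
qed

lemma inf_add_zero:
  fixes x y z :: "'a::vector_lattice"
  assumes "0 \<le> x" "0 \<le> y" "0 \<le> z" "inf x z = 0" "inf y z = 0"
  shows "inf (x + y) z = 0"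
  using inf_add_le[of x y z] assms by (intro antisym) auto

lemma inf_scale_zero:
  fixes x z :: "'a::vector_lattice"
  assumes "0 \<le> x" "0 \<le> z" "inf x z = 0" "c \<ge> 0"
  shows "inf (c *\<^sub>R x) z = 0"
proof -
  have n: "inf (real n *\<^sub>R x) z = 0" for n
  proof (induct n)
    case 0 then show ?case using assms by (simp add: inf_absorb1)
  next
    case (Suc n)
    have "0 \<le> real n *\<^sub>R x" using assms by (simp add: scaleR_nonneg_nonneg)
    then show ?case using inf_add_zero[of x "real n *\<^sub>R x" z] Suc assms
      by (simp add: scaleR_add_left)
  qed
  obtain n where "c \<le> real n" using real_arch_simple by blast
  then have "inf (c *\<^sub>R x) z \<le> inf (real n *\<^sub>R x) z"
    using assms by (intro inf_mono scaleR_right_mono) auto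
  moreover have "0 \<le> inf (c *\<^sub>R x) z" using assms by (simp add: scaleR_nonneg_nonneg)
  ultimately show ?thesis using n by (metis antisym)
qed

lemma decomp_nonneg:
  fixes a x :: "'a::vector_lattice"
  assumes arch: "archimedean_lattice TYPE('a)" and a: "is_atom a" and x: "0 \<le> x"
  obtains c :: real where "c \<ge> 0" "c *\<^sub>R a \<le> x" "inf (x - c *\<^sub>R a) a = 0"
proof -
  have a0: "0 < a" and at: "\<And>y. 0 \<le> y \<Longrightarrow> y \<le> a \<Longrightarrow> \<exists>c::real. c \<ge> 0 \<and> y = c *\<^sub>R a"
    using a by (auto simp: is_atom_def)
  define L where "L = {c::real. c \<ge> 0 \<and> c *\<^sub>R a \<le> x}"
  have ne: "0 \<in> L" using x by (simp add: L_def)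
  have "\<not> (\<forall>n::nat. real n *\<^sub>R a \<le> x)"
    using arch a0 unfolding archimedean_lattice_def by (metis not_le less_le_not_le)
  then obtain N :: nat where N: "\<not> real N *\<^sub>R a \<le> x" by blast
  have bd: "c \<le> real N" if "c \<in> L" for c
  proof (rule ccontr)
    assume "\<not> c \<le> real N"
    then have "real N *\<^sub>R a \<le> c *\<^sub>R a" using a0 by (intro scaleR_right_mono) auto
    then show False using N that by (auto simp: L_def dest: order_trans)
  qed
  have bdd: "bdd_above L" by (rule bdd_aboveI) (rule bd)
  define c where "c = Sup L"
  have c0: "c \<ge> 0" unfolding c_def by (rule cSup_upper[OF ne bdd])
  have "real n *\<^sub>R (c *\<^sub>R a - x) \<le> a" for n
  proof (cases "n = 0")
    case True then show ?thesis using a0 by simp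
  next
    case False
    then have "c - 1 / real n < Sup L" unfolding c_def by simp
    then obtain d where d: "d \<in> L" "c - 1 / real n < d"
      using ne less_cSup_iff[OF _ bdd] by blast
    have "c *\<^sub>R a \<le> (d + 1 / real n) *\<^sub>R a"
      using d a0 by (intro scaleR_right_mono) auto
    also have "\<dots> \<le> x + (1 / real n) *\<^sub>R a"
      using d by (simp add: L_def scaleR_add_left)
    finally have "c *\<^sub>R a - x \<le> (1 / real n) *\<^sub>R a"
      by (simp add: diff_le_eq add.commute)
    then have "real n *\<^sub>R (c *\<^sub>R a - x) \<le> real n *\<^sub>R ((1 / real n) *\<^sub>R a)"
      by (intro scaleR_left_mono) auto
    then show ?thesis using False by simp
  qed
  then have "c *\<^sub>R a - x \<le> 0" using arch unfolding archimedean_lattice_def by blast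
  then have cx: "c *\<^sub>R a \<le> x" by simp
  define m where "m = inf (x - c *\<^sub>R a) a"
  have "0 \<le> m" "m \<le> a" using cx a0 by (auto simp: m_def)
  then obtain d :: real where d: "d \<ge> 0" "m = d *\<^sub>R a" using at by blast
  have "d *\<^sub>R a \<le> x - c *\<^sub>R a" using d by (metis m_def inf.cobounded1)
  then have "(c + d) *\<^sub>R a \<le> x" by (simp add: scaleR_add_left le_diff_eq add.commute)
  then have "c + d \<in> L" using d c0 by (simp add: L_def)
  then have "c + d \<le> c" unfolding c_def using bdd by (rule cSup_upper)
  then have "m = 0" using d by simp
  then show thesis using that[OF c0 cx] unfolding m_def by simp
qed

lemma pos_neg_parts: "x = sup x 0 - sup (- x) (0::'a::vector_lattice)"
  using prts[of x] by (simp add: pprt_def[symmetric] pprt_neg)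

lemma decomp:
  fixes a x :: "'a::vector_lattice"
  assumes arch: "archimedean_lattice TYPE('a)" and a: "is_atom a"
  obtains c :: real where "inf \<bar>x - c *\<^sub>R a\<bar> a = 0"
proof -
  have a0: "0 \<le> a" using a by (auto simp: is_atom_def)
  define p q where "p = sup x 0" and "q = sup (-x) 0"
  have pq: "0 \<le> p" "0 \<le> q" by (auto simp: p_def q_def)
  have "x = p - q"
    unfolding p_def q_def by (rule pos_neg_parts)
  obtain c where c: "c *\<^sub>R a \<le> p" "inf (p - c *\<^sub>R a) a = 0"
    using decomp_nonneg[OF arch a pq(1)] by blast
  obtain d where d: "d *\<^sub>R a \<le> q" "inf (q - d *\<^sub>R a) a = 0"
    using decomp_nonneg[OF arch a pq(2)] by blast
  have "inf ((p - c *\<^sub>R a) + (q - d *\<^sub>R a)) a = 0"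
    using c d a0 by (intro inf_add_zero) auto
  moreover have "\<bar>x - (c - d) *\<^sub>R a\<bar> \<le> (p - c *\<^sub>R a) + (q - d *\<^sub>R a)"
  proof -
    have "x - (c - d) *\<^sub>R a = (p - c *\<^sub>R a) - (q - d *\<^sub>R a)"
      using \<open>x = p - q\<close> by (simp add: scaleR_diff_left)
    also have "\<bar>\<dots>\<bar> \<le> \<bar>p - c *\<^sub>R a\<bar> + \<bar>q - d *\<^sub>R a\<bar>" by (rule abs_triangle_ineq4)
    finally show ?thesis using c d by simp
  qed
  ultimately have "inf \<bar>x - (c - d) *\<^sub>R a\<bar> a \<le> 0"
    by (metis inf_mono order_refl)
  then have "inf \<bar>x - (c - d) *\<^sub>R a\<bar> a = 0" using a0 by (intro antisym) auto
  then show thesis using that by blast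
qed

lemma abs_scale_atom:
  fixes a :: "'a::vector_lattice"
  assumes "0 \<le> a" shows "\<bar>c *\<^sub>R a\<bar> = \<bar>c\<bar> *\<^sub>R a"
proof (cases "c \<ge> 0")
  case True then show ?thesis using assms by (simp add: abs_of_nonneg scaleR_nonneg_nonneg)
next
  case False
  then have "0 \<le> (-c) *\<^sub>R a" using assms by (intro scaleR_nonneg_nonneg) auto
  then have "\<bar>(-c) *\<^sub>R a\<bar> = (-c) *\<^sub>R a" by (rule abs_of_nonneg)
  then show ?thesis using False by (simp add: abs_if)
qed

lemma band_span_atom:
  fixes a :: "'a::vector_lattice"
  assumes arch: "archimedean_lattice TYPE('a)" and a: "is_atom a"
  shows "band (span {a})"
proof -
  have a0: "0 \<le> a" "a \<noteq> 0" and at: "\<And>y. 0 \<le> y \<Longrightarrow> y \<le> a \<Longrightarrow> \<exists>c::real. c \<ge> 0 \<and> y = c *\<^sub>R a"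
    using a by (auto simp: is_atom_def)
  have pos: "y \<in> span {a}" if "0 \<le> y" "y \<le> c *\<^sub>R a" "c > 0" for y c
  proof -
    have "inverse c *\<^sub>R y \<le> inverse c *\<^sub>R (c *\<^sub>R a)" using that by (intro scaleR_left_mono) auto
    then have "inverse c *\<^sub>R y \<le> a" using \<open>c > 0\<close> by simp
    moreover have "0 \<le> inverse c *\<^sub>R y" using that by (simp add: scaleR_nonneg_nonneg)
    ultimately obtain d where "inverse c *\<^sub>R y = d *\<^sub>R a" using at by blast
    then have "c *\<^sub>R inverse c *\<^sub>R y = c *\<^sub>R d *\<^sub>R a" by simp
    then have "y = (c * d) *\<^sub>R a" using that by simp
    then show ?thesis by (simp add: span_breakdown_eq)
  qed
  have "x \<in> span {a}" if y: "y \<in> span {a}" "\<bar>x\<bar> \<le> \<bar>y\<bar>" for x y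
  proof -
    obtain c where "y = c *\<^sub>R a" using y by (auto simp: span_singleton)
    then have "\<bar>x\<bar> \<le> \<bar>c\<bar> *\<^sub>R a" using that abs_scale_atom[OF a0(1)] by simp
    also have "\<dots> \<le> (\<bar>c\<bar> + 1) *\<^sub>R a" using a0 by (intro scaleR_right_mono) auto
    finally have le: "\<bar>x\<bar> \<le> (\<bar>c\<bar> + 1) *\<^sub>R a" .
    have "sup x 0 \<le> \<bar>x\<bar>" "sup (-x) 0 \<le> \<bar>x\<bar>"
      using abs_ge_self[of x] abs_ge_minus_self[of x] by auto
    then have "sup x 0 \<in> span {a}" "sup (-x) 0 \<in> span {a}"
      using order_trans[OF _ le] by (blast intro: pos[of _ "\<bar>c\<bar> + 1"] sup_ge2 add_nonneg_pos abs_ge_zero zero_less_one)+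
    moreover have "x = sup x 0 - sup (-x) 0"
      by (rule pos_neg_parts)
    ultimately show ?thesis by (metis span_diff)
  qed
  then have ideal: "order_ideal (span {a})"
    by (auto simp: order_ideal_def solid_def)
  have "s \<in> span {a}" if S: "S \<subseteq> span {a}" "isLub UNIV S s" for S s
  proof (cases "S = {}")
    case True
    then have "s \<le> t" for t using S by (auto simp: isLub_def leastP_def isUb_def setle_def setge_def)
    from this[of "s + s"] this[of 0] have "s = 0" by simp
    then show ?thesis by (simp add: span_zero)
  next
    case False
    obtain c where c: "inf \<bar>s - c *\<^sub>R a\<bar> a = 0" using decomp[OF arch a] by blast
    have "t \<le> c *\<^sub>R a" if "t \<in> S" for t
    proof -
      obtain d where d: "t = d *\<^sub>R a" using S \<open>t \<in> S\<close> by (auto simp: span_singleton)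
      have ts: "t \<le> s" using isLubD2[OF S(2) \<open>t \<in> S\<close>] .
      have "d \<le> c"
      proof (rule ccontr)
        assume "\<not> d \<le> c"
        then have e: "min 1 (d - c) > 0" by simp
        have "min 1 (d - c) *\<^sub>R a \<le> (d - c) *\<^sub>R a" using a0 by (intro scaleR_right_mono) auto
        also have "\<dots> \<le> s - c *\<^sub>R a" using ts d by (simp add: scaleR_diff_left)
        also have "\<dots> \<le> \<bar>s - c *\<^sub>R a\<bar>" by (rule abs_ge_self)
        finally have 1: "min 1 (d - c) *\<^sub>R a \<le> \<bar>s - c *\<^sub>R a\<bar>" .
        have "min 1 (d - c) *\<^sub>R a \<le> 1 *\<^sub>R a" using a0 by (intro scaleR_right_mono) auto
        then have "min 1 (d - c) *\<^sub>R a \<le> 0" using 1 c by (metis le_inf_iff scaleR_one)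
        moreover have "0 \<le> min 1 (d - c) *\<^sub>R a" using e a0 by (intro scaleR_nonneg_nonneg) auto
        ultimately have "min 1 (d - c) *\<^sub>R a = 0" by (rule antisym)
        then show False using e a0 by simp
      qed
      then show ?thesis using d a0 by (auto intro: scaleR_right_mono)
    qed
    then have "s \<le> c *\<^sub>R a"
      using S by (auto simp: isLub_def leastP_def isUb_def setle_def setge_def)
    moreover obtain t where "t \<in> S" using False by blast
    then obtain d where d: "d *\<^sub>R a \<in> S" using S by (auto simp: span_singleton)
    then have "d *\<^sub>R a \<le> s" using isLubD2[OF S(2)] by blast
    ultimately have "\<bar>s - d *\<^sub>R a\<bar> \<le> \<bar>c *\<^sub>R a - d *\<^sub>R a\<bar>" by (simp add: abs_of_nonneg)
    moreover have "c *\<^sub>R a - d *\<^sub>R a \<in> span {a}" by (simp add: span_base span_diff span_scale)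
    ultimately have "s - d *\<^sub>R a \<in> span {a}" using ideal by (auto simp: order_ideal_def solid_def)
    then show ?thesis by (metis diff_add_cancel span_add span_base span_scale singletonI)
  qed
  then show ?thesis using ideal by (auto simp: band_def)
qed

lemma band_hull_atom:
  fixes a :: "'a::vector_lattice"
  assumes "archimedean_lattice TYPE('a)" "is_atom a"
  shows "band hull {a} = span {a}"
proof (rule hull_unique)
  show "band (span {a})" using assms by (rule band_span_atom)
  show "span {a} \<subseteq> B" if "{a} \<subseteq> B" "band B" for B
    using that by (intro span_minimal) (auto simp: band_def order_ideal_def)
  show "{a} \<subseteq> span {a}" by (rule span_superset)
qed

lemma projection_band_atom:
  fixes a :: "'a::vector_lattice"
  assumes "archimedean_lattice TYPE('a)" "is_atom a"
  shows "\<exists>!y. y \<in> band hull {a} \<and> x - y \<in> disjoint_complement (band hull {a})"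
proof -
  have a0: "0 \<le> a" using assms by (auto simp: is_atom_def)
  obtain c where c: "inf \<bar>x - c *\<^sub>R a\<bar> a = 0" using decomp[OF assms] by blast
  have ex: "x - c *\<^sub>R a \<in> disjoint_complement (span {a})"
    unfolding disjoint_complement_def
    using inf_scale_zero[OF a0, of "\<bar>x - c *\<^sub>R a\<bar>"] c abs_scale_atom[OF a0]
    by (auto simp: span_singleton inf.commute)
  have "c *\<^sub>R a = y" if y: "y \<in> span {a}" "x - y \<in> disjoint_complement (span {a})" for y
  proof -
    have d: "c *\<^sub>R a - y \<in> span {a}" (is "?d \<in> _") using y by (simp add: span_base span_diff span_scale)
    then have "inf \<bar>x - y\<bar> \<bar>?d\<bar> = 0" "inf \<bar>x - c *\<^sub>R a\<bar> \<bar>?d\<bar> = 0"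
      using y ex by (auto simp: disjoint_complement_def)
    then have "inf (\<bar>x - y\<bar> + \<bar>x - c *\<^sub>R a\<bar>) \<bar>?d\<bar> = 0" by (intro inf_add_zero) auto
    moreover have "\<bar>?d\<bar> \<le> \<bar>x - y\<bar> + \<bar>x - c *\<^sub>R a\<bar>"
      using abs_triangle_ineq4[of "x - y" "x - c *\<^sub>R a"] by simp
    ultimately have "\<bar>?d\<bar> = 0" by (simp add: inf_absorb2)
    then show ?thesis by simp
  qed
  moreover have "c *\<^sub>R a \<in> span {a}" by (simp add: span_base span_scale)
  ultimately show ?thesis unfolding band_hull_atom[OF assms] using ex by blast
qed

lemma representation_scale_self:
  fixes a :: "'a::real_vector" assumes "a \<noteq> 0"
  shows "representation {a} (c *\<^sub>R a) a = c"
proof -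
  have i: "independent {a}" using assms by (simp only: dependent_single not_False_eq_True)
  have s: "a \<in> span {a}" by (rule span_base) (rule singletonI)
  have "representation {a} (c *\<^sub>R a) a = c * representation {a} a a"
    using real_vector.representation_scale[OF i s] by simp
  also have "representation {a} a a = 1"
    using real_vector.representation_basis[OF i, of a] by simp
  finally show ?thesis by simp
qed


section \<open>Nets\<close>

text \<open>
  A net is a family restricted to a directed set \<open>A\<close>, preordered by a relation \<open>r\<close>, where
  \<open>(i, j) \<in> r\<close> means that \<open>j\<close> comes after \<open>i\<close>.
\<close>

definition directed_set :: "'i set \<Rightarrow> 'i rel \<Rightarrow> bool" where
  "directed_set A r \<longleftrightarrow>
     A \<noteq> {} \<and> preorder_on A r \<and> (\<forall>i\<in>A. \<forall>j\<in>A. \<exists>k\<in>A. (i, k) \<in> r \<and> (j, k) \<in> r)"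

definition decreases_to_zero :: "'b set \<Rightarrow> 'b rel \<Rightarrow> ('b \<Rightarrow> 'a::vector_lattice) \<Rightarrow> bool" where
  "decreases_to_zero B s y \<longleftrightarrow>
     directed_set B s \<and>
     (\<forall>i\<in>B. \<forall>j\<in>B. (i, j) \<in> s \<longrightarrow> y j \<le> y i) \<and>
     isGlb UNIV (y ` B) 0"

definition dominated_by ::
    "'i set \<Rightarrow> 'i rel \<Rightarrow> ('i \<Rightarrow> 'a::vector_lattice) \<Rightarrow> 'a \<Rightarrow> 'b set \<Rightarrow> ('b \<Rightarrow> 'a) \<Rightarrow> bool" where
  "dominated_by A r x l B y \<longleftrightarrow>
     (\<forall>b\<in>B. \<exists>i\<in>A. \<forall>j\<in>A. (i, j) \<in> r \<longrightarrow> \<bar>x j - l\<bar> \<le> y b)"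

text \<open>
  HOL cannot quantify over the type of the index set of the dominating net, so \<open>B\<close> ranges over
  the preordered subsets of the vector lattice itself. This is no restriction: by
  \<open>order_convergesI\<close> below, a dominating net with an index set of any type will do.
\<close>

definition order_converges ::
    "'i set \<Rightarrow> 'i rel \<Rightarrow> ('i \<Rightarrow> 'a::vector_lattice) \<Rightarrow> 'a \<Rightarrow> bool" where
  "order_converges A r x l \<longleftrightarrow>
     (\<exists>(B :: 'a set) s y. decreases_to_zero B s y \<and> dominated_by A r x l B y)"

lemma order_convergesI:
  fixes B :: "'b set" and y :: "'b \<Rightarrow> 'a::vector_lattice"
  assumes "decreases_to_zero B s y" "dominated_by A r x l B y"
  shows "order_converges A r x l"
proof -
  define s' where "s' = {(u, v). u \<in> y ` B \<and> v \<in> y ` B \<and> v \<le> u}"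
  have ne: "B \<noteq> {}"
    and dir: "\<And>i j. i \<in> B \<Longrightarrow> j \<in> B \<Longrightarrow> \<exists>k\<in>B. (i, k) \<in> s \<and> (j, k) \<in> s"
    and dec: "\<And>i j. i \<in> B \<Longrightarrow> j \<in> B \<Longrightarrow> (i, j) \<in> s \<Longrightarrow> y j \<le> y i"
    and glb: "isGlb UNIV (y ` B) 0"
    using assms(1) by (auto simp: decreases_to_zero_def directed_set_def)
  have "preorder_on (y ` B) s'"
    unfolding preorder_on_def s'_def refl_on_def trans_def by auto
  moreover have "\<exists>k\<in>y ` B. (u, k) \<in> s' \<and> (v, k) \<in> s'" if "u \<in> y ` B" "v \<in> y ` B" for u v
  proof -
    obtain i j where ij: "i \<in> B" "j \<in> B" "u = y i" "v = y j"
      using \<open>u \<in> y ` B\<close> \<open>v \<in> y ` B\<close> by blast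
    obtain k where "k \<in> B" "(i, k) \<in> s" "(j, k) \<in> s"
      using dir ij by blast
    then have "k \<in> B" "y k \<le> u" "y k \<le> v"
      using dec ij by blast+
    then show ?thesis
      unfolding s'_def using that by blast
  qed
  ultimately have "decreases_to_zero (y ` B) s' (\<lambda>u. u)"
    unfolding decreases_to_zero_def directed_set_def using ne glb by (auto simp: s'_def)
  moreover have "dominated_by A r x l (y ` B) (\<lambda>u. u)"
    using assms(2) by (auto simp: dominated_by_def)
  ultimately show ?thesis
    unfolding order_converges_def by blast
qed

definition uo_converges ::
    "'i set \<Rightarrow> 'i rel \<Rightarrow> ('i \<Rightarrow> 'a::vector_lattice) \<Rightarrow> 'a \<Rightarrow> bool" where
  "uo_converges A r x l \<longleftrightarrow> (\<forall>u\<ge>0. order_converges A r (\<lambda>i. inf \<bar>x i - l\<bar> u) 0)"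

text \<open>The filter of tails of a net, which makes the library's limits available for nets of reals.\<close>

definition net_filter :: "'i set \<Rightarrow> 'i rel \<Rightarrow> 'i filter" where
  "net_filter A r = (INF i\<in>A. principal {j \<in> A. (i, j) \<in> r})"

lemma eventually_net_filter:
  assumes "directed_set A r"
  shows "eventually P (net_filter A r) \<longleftrightarrow> (\<exists>i\<in>A. \<forall>j\<in>A. (i, j) \<in> r \<longrightarrow> P j)"
proof -
  have ne: "A \<noteq> {}" and tr: "trans r"
    and dir: "\<And>i j. i \<in> A \<Longrightarrow> j \<in> A \<Longrightarrow> \<exists>k\<in>A. (i, k) \<in> r \<and> (j, k) \<in> r"
    using assms by (auto simp: directed_set_def preorder_on_def)
  have "eventually P (net_filter A r) \<longleftrightarrow>
      (\<exists>i\<in>A. eventually P (principal {j \<in> A. (i, j) \<in> r}))"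
    unfolding net_filter_def
  proof (rule eventually_INF_base[OF ne])
    fix i j assume "i \<in> A" "j \<in> A"
    then obtain k where "k \<in> A" "(i, k) \<in> r" "(j, k) \<in> r"
      using dir by blast
    then show "\<exists>k\<in>A. principal {l \<in> A. (k, l) \<in> r} \<le>
        inf (principal {l \<in> A. (i, l) \<in> r}) (principal {l \<in> A. (j, l) \<in> r})"
      using tr by (intro bexI[of _ k]) (auto dest: transD)
  qed
  then show ?thesis
    by (auto simp: eventually_principal)
qed

text \<open>
  The term \<open>representation {a} v a\<close> is the coefficient \<open>c\<close> in \<open>v = c *\<^sub>R a\<close>, for \<open>v\<close> in \<open>span {a}\<close>
  (see \<open>representation_scale_self\<close>).
\<close>

definition converges_in_line ::
    "'a::real_vector \<Rightarrow> 'i set \<Rightarrow> 'i rel \<Rightarrow> ('i \<Rightarrow> 'a) \<Rightarrow> 'a \<Rightarrow> bool" where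
  "converges_in_line a A r v l \<longleftrightarrow>
     ((\<lambda>i. representation {a} (v i) a) \<longlongrightarrow> representation {a} l a) (net_filter A r)"

definition converges_pointwise ::
    "'i set \<Rightarrow> 'i rel \<Rightarrow> ('i \<Rightarrow> 'a::vector_lattice) \<Rightarrow> 'a \<Rightarrow> bool" where
  "converges_pointwise A r x l \<longleftrightarrow>
     (\<forall>a. is_atom a \<longrightarrow>
        converges_in_line a A r (\<lambda>i. band_projection (band hull {a}) (x i))
          (band_projection (band hull {a}) l))"

end

theory Submission
  imports Defs
begin

text \<open>
  Fix an atom \<open>a\<close> and write \<open>c z\<close> for the coefficient of \<open>P\<^sub>a z\<close>, which is \<open>atom_coeff a z\<close> below.
  The functional \<open>c\<close> is linear and commutes with absolute values, hence is monotone, and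
  \<open>c z *\<^sub>R a \<le> z\<close> for positive \<open>z\<close>.

  Unbounded order convergence implies pointwise convergence by testing it on \<open>u = a\<close>: if
  \<open>\<bar>c (x i) - c l\<bar> \<ge> \<epsilon>\<close> for cofinally many \<open>i\<close>, with \<open>\<epsilon> \<le> 1\<close>, then \<open>\<epsilon> *\<^sub>R a\<close> lies below
  \<open>inf \<bar>x i - l\<bar> a\<close> for these \<open>i\<close>, and therefore below every member of a dominating net, whose
  infimum is 0.

  Conversely, fix \<open>u \<ge> 0\<close>. The natural candidate for the dominating net is the set \<open>Y\<close> of all eventual
  upper bounds of \<open>inf \<bar>x i - l\<bar> u\<close>, ordered downwards; only \<open>Inf Y = 0\<close> is at stake. Since atoms
  generate the space as a band, and the elements disjoint from a given vector form a band, a nonzero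
  positive lower bound \<open>w\<close> of \<open>Y\<close> has \<open>c w > 0\<close> for some atom \<open>a\<close>
  (\<open>atomic_lattice_atom_coeff_pos\<close>). But convergence of the single
  coordinate \<open>c\<close> already puts into \<open>Y\<close> the vector obtained from \<open>u\<close> by replacing its coordinate at \<open>a\<close> by
  \<open>c w / 2\<close>. That vector cannot dominate \<open>w\<close>.
\<close>

section \<open>Disjoint complements\<close>

lemma abs_scaleR_le:
  fixes x :: "'a::vector_lattice"
  shows "\<bar>c *\<^sub>R x\<bar> \<le> \<bar>c\<bar> *\<^sub>R \<bar>x\<bar>"
proof -
  have nonneg: "\<bar>d *\<^sub>R y\<bar> \<le> d *\<^sub>R \<bar>y\<bar>" if "d \<ge> 0" for d and y :: 'a
  proof (rule abs_leI)
    show "d *\<^sub>R y \<le> d *\<^sub>R \<bar>y\<bar>"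
      using that by (intro scaleR_left_mono abs_ge_self)
    have "d *\<^sub>R (- y) \<le> d *\<^sub>R \<bar>y\<bar>"
      using that by (intro scaleR_left_mono abs_ge_minus_self)
    then show "- (d *\<^sub>R y) \<le> d *\<^sub>R \<bar>y\<bar>" by simp
  qed
  show ?thesis
    using nonneg[of c x] nonneg[of "- c" "- x"] by (cases "c \<ge> 0") auto
qed

lemma order_ideal_disjoint_complement:
  fixes W :: "'a::vector_lattice set"
  shows "order_ideal (disjoint_complement W)"
proof -
  have solid: "inf \<bar>x\<bar> \<bar>w\<bar> = 0"
    if "inf y \<bar>w\<bar> = 0" "\<bar>x\<bar> \<le> y" for x y w :: 'a
  proof (rule antisym)
    show "inf \<bar>x\<bar> \<bar>w\<bar> \<le> 0"
      using inf_mono[OF that(2) order_refl, of "\<bar>w\<bar>"] that(1) by simp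
  qed simp
  have "inf \<bar>x + y\<bar> \<bar>w\<bar> = 0" if "inf \<bar>x\<bar> \<bar>w\<bar> = 0" "inf \<bar>y\<bar> \<bar>w\<bar> = 0" for x y w :: 'a
    using solid[OF inf_add_zero[of "\<bar>x\<bar>" "\<bar>y\<bar>" "\<bar>w\<bar>"] abs_triangle_ineq] that by simp
  moreover have "inf \<bar>d *\<^sub>R x\<bar> \<bar>w\<bar> = 0" if "inf \<bar>x\<bar> \<bar>w\<bar> = 0" for d and x w :: 'a
    using solid[OF inf_scale_zero[of "\<bar>x\<bar>" "\<bar>w\<bar>" "\<bar>d\<bar>"] abs_scaleR_le] that by simp
  ultimately have "subspace (disjoint_complement W)"
    by (auto simp: subspace_def disjoint_complement_def inf_absorb1)
  moreover have "solid (disjoint_complement W)"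
    unfolding solid_def disjoint_complement_def using solid by blast
  ultimately show ?thesis
    by (simp add: order_ideal_def)
qed

text \<open>
  For closure under suprema, let \<open>s\<close> be the supremum of a set of vectors \<open>t\<close> disjoint from \<open>w\<close>, and
  let \<open>m\<close> be the infimum of the positive part of \<open>s\<close> and \<open>\<bar>w\<bar>\<close>. Since \<open>m\<close> is disjoint from the positive
  part of each \<open>t\<close>, the join of the two, which is below the positive part of \<open>s\<close>, is their sum. As the
  negative part of \<open>s\<close> is at most that of \<open>t\<close>, this makes \<open>s - m\<close> an upper bound too, so \<open>m = 0\<close>.
\<close>

lemma band_disjoint_complement:
  fixes W :: "'a::vector_lattice set"
  shows "band (disjoint_complement W)"
proof -
  let ?D = "disjoint_complement W"
  have "s \<in> ?D" if S: "S \<subseteq> ?D" and s: "isLub UNIV S s" for S s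
  proof (cases "S = {}")
    case True
    \<comment> \<open>The supremum of the empty set is a least element, which exists only in the zero space.\<close>
    then have "s \<le> t" for t
      using s by (auto simp: isLub_def leastP_def isUb_def setle_def setge_def)
    from this[of "s + s"] this[of 0] have "s = 0" by simp
    then show ?thesis by (simp add: disjoint_complement_def inf_absorb1)
  next
    case False
    then obtain t0 where t0: "t0 \<in> S" by blast
    have ub: "t \<le> s" if "t \<in> S" for t
      using isLubD2[OF s that] .
    have "inf \<bar>s\<bar> \<bar>w\<bar> = 0" if w: "w \<in> W" for w
    proof -
      have disj: "inf (sup t 0) \<bar>w\<bar> = 0" "inf (sup (- t) 0) \<bar>w\<bar> = 0" if "t \<in> S" for t
      proof -
        have "inf \<bar>t\<bar> \<bar>w\<bar> = 0"
          using S w that by (auto simp: disjoint_complement_def)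
        moreover have "sup t 0 \<le> \<bar>t\<bar>" "sup (- t) 0 \<le> \<bar>t\<bar>"
          using abs_ge_self[of t] abs_ge_minus_self[of t] by auto
        ultimately have "inf (sup t 0) \<bar>w\<bar> \<le> 0" "inf (sup (- t) 0) \<bar>w\<bar> \<le> 0"
          using inf_mono[of _ "\<bar>t\<bar>" "\<bar>w\<bar>" "\<bar>w\<bar>"] by (metis order_refl)+
        then show "inf (sup t 0) \<bar>w\<bar> = 0" "inf (sup (- t) 0) \<bar>w\<bar> = 0"
          by (auto intro: antisym)
      qed
      define m where "m = inf (sup s 0) \<bar>w\<bar>"
      have m0: "0 \<le> m" by (simp add: m_def)
      have "t \<le> s - m" if t: "t \<in> S" for t
      proof -
        have "inf (sup t 0) m \<le> inf (sup t 0) \<bar>w\<bar>"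
          by (intro inf_mono) (auto simp: m_def)
        then have "inf (sup t 0) m = 0"
          using disj(1)[OF t] m0 by (intro antisym) auto
        then have "sup t 0 + m = sup (sup t 0) m"
          using add_eq_inf_sup[of "sup t 0" m] by simp
        also have "\<dots> \<le> sup s 0"
          using ub[OF t] by (auto simp: m_def intro: le_supI1)
        finally have "sup t 0 + m \<le> sup s 0" .
        moreover have "sup (- s) 0 \<le> sup (- t) 0"
          using ub[OF t] by (intro sup_mono) auto
        ultimately have "(sup t 0 + m) - sup (- t) 0 \<le> sup s 0 - sup (- s) 0"
          by (rule diff_mono)
        moreover have "(sup t 0 + m) - sup (- t) 0 = t + m"
          by (simp only: diff_add_eq[symmetric] pos_neg_parts[symmetric])
        ultimately have "t + m \<le> s"
          by (simp only: pos_neg_parts[symmetric])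
        then show ?thesis by (simp add: le_diff_eq)
      qed
      then have "s \<le> s - m"
        using s by (auto simp: isLub_def leastP_def isUb_def setle_def setge_def)
      then have "m = 0" using m0 by (intro antisym) auto
      then have pos: "inf (sup s 0) \<bar>w\<bar> = 0" by (simp add: m_def)
      \<comment> \<open>The negative part of \<open>s\<close> is below that of any member of \<open>S\<close>.\<close>
      have "inf (sup (- s) 0) \<bar>w\<bar> \<le> inf (sup (- t0) 0) \<bar>w\<bar>"
        using ub[OF t0] by (intro inf_mono sup_mono) auto
      then have neg: "inf (sup (- s) 0) \<bar>w\<bar> = 0"
        using disj(2)[OF t0] by (intro antisym) auto
      have "inf (sup s 0 + sup (- s) 0) \<bar>w\<bar> = 0"
        using pos neg by (intro inf_add_zero) auto
      moreover have "\<bar>s\<bar> \<le> sup s 0 + sup (- s) 0"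
      proof (rule abs_leI)
        show "s \<le> sup s 0 + sup (- s) 0" "- s \<le> sup s 0 + sup (- s) 0"
          using add_mono[of s "sup s 0" 0 "sup (- s) 0"]
            add_mono[of 0 "sup s 0" "- s" "sup (- s) 0"] by simp_all
      qed
      ultimately have "inf \<bar>s\<bar> \<bar>w\<bar> \<le> 0"
        using inf_mono[of "\<bar>s\<bar>" "sup s 0 + sup (- s) 0" "\<bar>w\<bar>" "\<bar>w\<bar>"] by simp
      then show ?thesis by (intro antisym) simp_all
    qed
    then show ?thesis by (simp add: disjoint_complement_def)
  qed
  then show ?thesis
    using order_ideal_disjoint_complement by (auto simp: band_def)
qed


section \<open>The coefficient at an atom\<close>

definition atom_coeff :: "'a::vector_lattice \<Rightarrow> 'a \<Rightarrow> real" where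
  "atom_coeff a x = representation {a} (band_projection (band hull {a}) x) a"

lemma converges_pointwise_iff:
  "converges_pointwise A r x l \<longleftrightarrow>
     (\<forall>a. is_atom a \<longrightarrow> ((\<lambda>i. atom_coeff a (x i)) \<longlongrightarrow> atom_coeff a l) (net_filter A r))"
  by (simp add: converges_pointwise_def converges_in_line_def atom_coeff_def)

context
  fixes a :: "'a::vector_lattice"
  assumes arch: "archimedean_lattice TYPE('a)" and atom: "is_atom a"
begin

lemma disjoint_complement_atom_iff: "x \<in> disjoint_complement {a} \<longleftrightarrow> inf \<bar>x\<bar> a = 0"
  using atom by (simp add: disjoint_complement_def is_atom_def abs_of_pos)

lemma atom_coeff_eqI:
  assumes "x - c *\<^sub>R a \<in> disjoint_complement {a}"
  shows "atom_coeff a x = c"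
proof -
  have a0: "0 \<le> a" "a \<noteq> 0" using atom by (auto simp: is_atom_def)
  have "inf a \<bar>x - c *\<^sub>R a\<bar> = 0"
    using assms by (simp add: disjoint_complement_atom_iff inf.commute)
  then have "x - c *\<^sub>R a \<in> disjoint_complement (band hull {a})"
    unfolding band_hull_atom[OF arch atom] disjoint_complement_def
    using inf_scale_zero[OF a0(1), of "\<bar>x - c *\<^sub>R a\<bar>"] abs_scale_atom[OF a0(1)]
    by (auto simp: span_singleton inf.commute)
  moreover have "c *\<^sub>R a \<in> band hull {a}"
    unfolding band_hull_atom[OF arch atom] by (simp add: span_base span_scale)
  ultimately have "band_projection (band hull {a}) x = c *\<^sub>R a"
    unfolding band_projection_def
    by (intro the1_equality projection_band_atom[OF arch atom]) auto
  then show ?thesis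
    using representation_scale_self[OF a0(2)] by (simp add: atom_coeff_def)
qed

lemma diff_atom_coeff_disjoint: "x - atom_coeff a x *\<^sub>R a \<in> disjoint_complement {a}"
proof -
  obtain c where "inf \<bar>x - c *\<^sub>R a\<bar> a = 0" using decomp[OF arch atom] by blast
  then have "x - c *\<^sub>R a \<in> disjoint_complement {a}"
    by (simp add: disjoint_complement_atom_iff)
  then show ?thesis using atom_coeff_eqI by metis
qed

lemma atom_coeff_diff: "atom_coeff a (x - y) = atom_coeff a x - atom_coeff a y"
proof (rule atom_coeff_eqI)
  have "(x - atom_coeff a x *\<^sub>R a) - (y - atom_coeff a y *\<^sub>R a) \<in> disjoint_complement {a}"
    using order_ideal_disjoint_complement[of "{a}"]
    by (intro subspace_diff diff_atom_coeff_disjoint) (simp add: order_ideal_def)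
  then show "x - y - (atom_coeff a x - atom_coeff a y) *\<^sub>R a \<in> disjoint_complement {a}"
    by (simp add: algebra_simps)
qed

lemma atom_coeff_scale_self: "atom_coeff a (c *\<^sub>R a) = c"
  by (rule atom_coeff_eqI) (simp add: disjoint_complement_def inf_absorb1)

lemma atom_coeff_abs: "atom_coeff a \<bar>x\<bar> = \<bar>atom_coeff a x\<bar>"
proof (rule atom_coeff_eqI)
  have "\<bar>\<bar>x\<bar> - \<bar>atom_coeff a x *\<^sub>R a\<bar>\<bar> \<le> \<bar>x - atom_coeff a x *\<^sub>R a\<bar>"
    by (rule abs_triangle_ineq3)
  moreover have "\<bar>atom_coeff a x *\<^sub>R a\<bar> = \<bar>atom_coeff a x\<bar> *\<^sub>R a"
    using atom by (intro abs_scale_atom) (auto simp: is_atom_def)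
  ultimately show "\<bar>x\<bar> - \<bar>atom_coeff a x\<bar> *\<^sub>R a \<in> disjoint_complement {a}"
    using diff_atom_coeff_disjoint[of x] order_ideal_disjoint_complement[of "{a}"]
    unfolding order_ideal_def solid_def by metis
qed

lemma
  assumes "0 \<le> x"
  shows atom_coeff_nonneg: "0 \<le> atom_coeff a x"
    and atom_coeff_scale_le: "atom_coeff a x *\<^sub>R a \<le> x"
proof -
  obtain c where c: "c \<ge> 0" "c *\<^sub>R a \<le> x" "inf (x - c *\<^sub>R a) a = 0"
    using decomp_nonneg[OF arch atom assms] by blast
  then have "x - c *\<^sub>R a \<in> disjoint_complement {a}"
    by (simp add: disjoint_complement_atom_iff)
  then have "atom_coeff a x = c" by (rule atom_coeff_eqI)
  then show "0 \<le> atom_coeff a x" "atom_coeff a x *\<^sub>R a \<le> x" using c by auto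
qed

lemma atom_coeff_mono: "x \<le> y \<Longrightarrow> atom_coeff a x \<le> atom_coeff a y"
  using atom_coeff_nonneg[of "y - x"] by (simp add: atom_coeff_diff)

end

lemma atomic_lattice_atom_coeff_pos:
  fixes w :: "'a::vector_lattice"
  assumes arch: "archimedean_lattice TYPE('a)" and atomic: "atomic_lattice TYPE('a)"
    and w: "0 \<le> w" "w \<noteq> 0"
  obtains a where "is_atom a" "atom_coeff a w > 0"
proof -
  have "\<exists>a. is_atom a \<and> atom_coeff a w \<noteq> 0"
  proof (rule ccontr)
    assume "\<not> ?thesis"
    then have zero: "atom_coeff a w = 0" if "is_atom a" for a using that by blast
    have "{a. is_atom a} \<subseteq> disjoint_complement {w}"
      using diff_atom_coeff_disjoint[OF arch, of _ w] zero
      by (auto simp: disjoint_complement_def inf.commute)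
    then have "band hull {a. is_atom a} \<subseteq> disjoint_complement {w}"
      by (rule hull_minimal) (rule band_disjoint_complement)
    then have "w \<in> disjoint_complement {w}"
      using atomic by (auto simp: atomic_lattice_def)
    then show False using w by (simp add: disjoint_complement_def)
  qed
  then obtain a where a: "is_atom a" "atom_coeff a w \<noteq> 0" by blast
  have "atom_coeff a w > 0"
    using a(2) atom_coeff_nonneg[OF arch a(1) w(1)] by linarith
  with a(1) show thesis by (rule that)
qed


section \<open>Unbounded order convergence and pointwise convergence\<close>

lemma uo_converges_imp_converges_pointwise:
  fixes x :: "'i \<Rightarrow> 'a::vector_lattice"
  assumes arch: "archimedean_lattice TYPE('a)" and dir: "directed_set A r"
    and uo: "uo_converges A r x l"
  shows "converges_pointwise A r x l"
  unfolding converges_pointwise_iff tendsto_iff eventually_net_filter[OF dir]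
proof (intro allI impI)
  fix a :: 'a and e :: real assume a: "is_atom a" and e: "e > 0"
  have a0: "0 \<le> a" "a \<noteq> 0" using a by (auto simp: is_atom_def)
  let ?c = "atom_coeff a"
  have "order_converges A r (\<lambda>i. inf \<bar>x i - l\<bar> a) 0"
    using uo a0 by (simp add: uo_converges_def)
  then obtain B :: "'a set" and s y
    where y: "decreases_to_zero B s y" "dominated_by A r (\<lambda>i. inf \<bar>x i - l\<bar> a) 0 B y"
    unfolding order_converges_def by blast
  \<comment> \<open>The coordinate of \<open>inf \<bar>x i - l\<bar> a\<close> never exceeds 1.\<close>
  define d where "d = min e 1"
  have d: "0 < d" "d \<le> e" "d \<le> 1" using e by (auto simp: d_def)
  show "\<exists>i\<in>A. \<forall>j\<in>A. (i, j) \<in> r \<longrightarrow> dist (?c (x j)) (?c l) < e"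
  proof (rule ccontr)
    assume far: "\<not> ?thesis"
    have "d *\<^sub>R a \<le> y b" if b: "b \<in> B" for b
    proof -
      obtain i where i: "i \<in> A" "\<And>j. j \<in> A \<Longrightarrow> (i, j) \<in> r \<Longrightarrow> abs (inf \<bar>x j - l\<bar> a - 0) \<le> y b"
        using y(2)[unfolded dominated_by_def, rule_format, OF b] by blast
      obtain j where j: "j \<in> A" "(i, j) \<in> r" "e \<le> \<bar>?c (x j) - ?c l\<bar>"
        using far i(1) unfolding dist_real_def not_less[symmetric] by blast
      have "d *\<^sub>R a \<le> \<bar>?c (x j) - ?c l\<bar> *\<^sub>R a"
        using d j a0 by (intro scaleR_right_mono) auto
      also have "\<dots> = ?c \<bar>x j - l\<bar> *\<^sub>R a"
        by (simp add: atom_coeff_abs[OF arch a] atom_coeff_diff[OF arch a])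
      also have "\<dots> \<le> \<bar>x j - l\<bar>"
        by (rule atom_coeff_scale_le[OF arch a]) simp
      finally have "d *\<^sub>R a \<le> \<bar>x j - l\<bar>" .
      moreover have "d *\<^sub>R a \<le> a"
        using scaleR_right_mono[OF d(3) a0(1)] by simp
      ultimately have "d *\<^sub>R a \<le> inf \<bar>x j - l\<bar> a" by simp
      also have "\<dots> \<le> y b"
        using order_trans[OF abs_ge_self i(2)[OF j(1,2)]] by simp
      finally show ?thesis .
    qed
    then have "d *\<^sub>R a \<le> 0"
      using y(1) by (auto simp: decreases_to_zero_def isGlb_def greatestP_def isLb_def
          setge_def setle_def)
    then have "?c (d *\<^sub>R a) \<le> ?c (0 *\<^sub>R a)"
      by (intro atom_coeff_mono[OF arch a]) simp
    then show False
      using d unfolding atom_coeff_scale_self[OF arch a] by simp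
  qed
qed

lemma decreases_to_zero_id:
  fixes Y :: "'a::vector_lattice set"
  assumes ne: "Y \<noteq> {}" and inf_closed: "\<And>u v. u \<in> Y \<Longrightarrow> v \<in> Y \<Longrightarrow> inf u v \<in> Y"
    and glb: "isGlb UNIV Y 0"
  shows "decreases_to_zero Y {(u, v). u \<in> Y \<and> v \<in> Y \<and> v \<le> u} (\<lambda>u. u)"
proof -
  have "preorder_on Y {(u, v). u \<in> Y \<and> v \<in> Y \<and> v \<le> u}"
    unfolding preorder_on_def refl_on_def trans_def by auto
  moreover have "\<exists>k\<in>Y. k \<le> u \<and> k \<le> v" if "u \<in> Y" "v \<in> Y" for u v
    using inf_closed[OF that] by (intro bexI[of _ "inf u v"]) auto
  ultimately show ?thesis
    using ne glb by (auto simp: decreases_to_zero_def directed_set_def)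
qed

text \<open>
  The bound comes from splitting off the coordinate at \<open>a\<close>: the part of \<open>v\<close> disjoint from \<open>a\<close> is at
  most that of \<open>u\<close>, because the projection onto the complement of the band of \<open>a\<close> is monotone.
\<close>

lemma le_replace_atom_coeff:
  fixes a u v :: "'a::vector_lattice"
  assumes arch: "archimedean_lattice TYPE('a)" and a: "is_atom a"
    and "v \<le> u" and c: "atom_coeff a v \<le> c"
  shows "v \<le> u - (atom_coeff a u - c) *\<^sub>R a"
proof -
  have a0: "0 \<le> a" using a by (auto simp: is_atom_def)
  have "(atom_coeff a u - c) *\<^sub>R a \<le> atom_coeff a (u - v) *\<^sub>R a"
    using c a0 by (intro scaleR_right_mono) (auto simp: atom_coeff_diff[OF arch a])
  also have "\<dots> \<le> u - v"
    using \<open>v \<le> u\<close> by (intro atom_coeff_scale_le[OF arch a]) simp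
  finally show ?thesis by (simp add: algebra_simps)
qed

lemma converges_pointwise_imp_uo_converges:
  fixes x :: "'i \<Rightarrow> 'a::vector_lattice"
  assumes arch: "archimedean_lattice TYPE('a)" and atomic: "atomic_lattice TYPE('a)"
    and dir: "directed_set A r" and pw: "converges_pointwise A r x l"
  shows "uo_converges A r x l"
  unfolding uo_converges_def
proof (intro allI impI)
  fix u :: 'a assume u: "0 \<le> u"
  define v where "v i = inf \<bar>x i - l\<bar> u" for i
  have v: "0 \<le> v i" "v i \<le> u" "v i \<le> \<bar>x i - l\<bar>" for i using u by (auto simp: v_def)
  define Y where "Y = {y. eventually (\<lambda>i. v i \<le> y) (net_filter A r)}"
  have "u \<in> Y" using v by (simp add: Y_def)
  have lower: "0 \<le> y" if y: "y \<in> Y" for y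
  proof -
    obtain i where "i \<in> A" "\<forall>j\<in>A. (i, j) \<in> r \<longrightarrow> v j \<le> y"
      using y by (auto simp: Y_def eventually_net_filter[OF dir])
    moreover have "(i, i) \<in> r"
      using dir \<open>i \<in> A\<close> by (auto simp: directed_set_def preorder_on_def refl_on_def)
    ultimately show ?thesis using v(1) order_trans by blast
  qed
  have greatest: "z \<le> 0" if z: "\<And>y. y \<in> Y \<Longrightarrow> z \<le> y" for z
  proof (rule ccontr)
    assume "\<not> z \<le> 0"
    define w where "w = sup z 0"
    have "0 \<le> w" by (simp add: w_def)
    moreover have "w \<noteq> 0" using \<open>\<not> z \<le> 0\<close> by (metis w_def sup_ge1)
    ultimately obtain a where a: "is_atom a" "atom_coeff a w > 0"
      by (rule atomic_lattice_atom_coeff_pos[OF arch atomic])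
    let ?c = "atom_coeff a"
    define y where "y = u - (?c u - ?c w / 2) *\<^sub>R a"
    have "eventually (\<lambda>i. dist (?c (x i)) (?c l) < ?c w / 2) (net_filter A r)"
      using pw[unfolded converges_pointwise_iff tendsto_iff, rule_format, OF a(1), of "?c w / 2"] a(2)
      by simp
    then have "eventually (\<lambda>i. v i \<le> y) (net_filter A r)"
    proof (rule eventually_mono)
      fix i assume i: "dist (?c (x i)) (?c l) < ?c w / 2"
      have "?c (v i) \<le> ?c \<bar>x i - l\<bar>"
        by (rule atom_coeff_mono[OF arch a(1) v(3)])
      also have "\<dots> \<le> ?c w / 2"
        using i by (simp add: atom_coeff_abs[OF arch a(1)] atom_coeff_diff[OF arch a(1)]
            dist_real_def)
      finally show "v i \<le> y"
        unfolding y_def by (rule le_replace_atom_coeff[OF arch a(1) v(2)])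
    qed
    then have "y \<in> Y" by (simp add: Y_def)
    then have "w \<le> y" using z lower by (simp add: w_def)
    then have "?c w \<le> ?c y" by (rule atom_coeff_mono[OF arch a(1)])
    also have "?c y = ?c w / 2"
      unfolding y_def by (simp add: atom_coeff_diff[OF arch a(1)] atom_coeff_scale_self[OF arch a(1)])
    finally show False using a(2) by simp
  qed
  have "isGlb UNIV Y 0"
    using lower greatest by (auto simp: isGlb_def greatestP_def isLb_def setge_def setle_def)
  moreover have "inf y y' \<in> Y" if "y \<in> Y" "y' \<in> Y" for y y'
    using that unfolding Y_def by (auto elim: eventually_elim2)
  ultimately have "decreases_to_zero Y {(u, v). u \<in> Y \<and> v \<in> Y \<and> v \<le> u} (\<lambda>u. u)"
    using \<open>u \<in> Y\<close> by (intro decreases_to_zero_id) auto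
  moreover have "dominated_by A r v 0 Y (\<lambda>u. u)"
    using v(1) by (auto simp: dominated_by_def Y_def eventually_net_filter[OF dir])
  ultimately have "order_converges A r v 0" by (rule order_convergesI)
  then show "order_converges A r (\<lambda>i. inf \<bar>x i - l\<bar> u) 0" by (simp add: v_def[abs_def])
qed

theorem proposition1:
  fixes A :: "'i set" and r :: "'i rel"
    and x :: "'i \<Rightarrow> 'a::vector_lattice" and l :: 'a
  assumes "archimedean_lattice TYPE('a)"
    and "atomic_lattice TYPE('a)"
    and "directed_set A r"
  shows "uo_converges A r x l \<longleftrightarrow> converges_pointwise A r x l"
  using assms uo_converges_imp_converges_pointwise converges_pointwise_imp_uo_converges
  by blast

end
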